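(* Let $M$ be a free $\mathbf{Z}^2$-persistence module of finite rank with a fixed basis, let $V\subseteq\operatorname{colim}M$ be a subspace, and let $B$ be a matrix representing a generating set of $V$. Then $[V]_M$ is free, and the algorithm Bireduce (described in the context), applied to $B$, calculates a graded matrix whose nonzero columns represent a basis of $[V]_M$.
   Context: Let $k$ be a field. A $\mathbf{Z}^2$-persistence module is a functor from the poset $\mathbf{Z}^2$ (product order) to finite-dimensional $k$-vector spaces. $F(z)$ is the module with $F(z)_w=k$ if $z\le w$ and $0$ otherwise, with identity structure maps between nonzero components. A free module is one isomorphic to $\bigoplus_iF(z_i)$; the images $m_i$ of the generators $1\in F(z_i)_{z_i}$ form a basis, with grades $g(m_i)=z_i$. For a module $M$ and a subspace $V\subseteq\operatorname{colim}M$, $[V]_M\subseteq M$ is the submodule with $([V]_M)_z=\{m\in M_z:\text{the image of }m\text{ in }\operatorname{colim}M\text{ lies in }V\}$. Let $m_1,\dots,m_s$ be the fixed basis of $M$, $r=(r_1,\dots,r_s)$ with $r_i=g(m_i)$. It induces a basis of the vector space $\operatorname{colim}M\cong k^s$; $B$ is an $s\times l$-matrix whose columns $B_1,\dots,B_l$, in these coordinates, generate $V$. Orders on $\mathbf{Z}^2$: $(x,y)\preceq_{\mathrm{lex}}(x',y')$ iff $x<x'$ or ($x=x'$ and $y\le y'$); $(x,y)\preceq_{\mathrm{colex}}(x',y')$ iff $y<y'$ or ($y=y'$ and $x\le x'$). For $0\neq b\in k^s$, the lex pivot $\operatorname{l-piv}(b)$ is the smallest index $i$ such that $b_i\ne0$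 and $r_i$ takes its maximum value (among $i$ with $b_i\neq 0$) with respect to $\preceq_{\mathrm{lex}}$; $\operatorname{c-piv}(b)$ is defined analogously with $\preceq_{\mathrm{colex}}$; both are $0$ for $b=0$. Colex pivots are compared as follows: $i$ is smaller than $i'$ if $r_i\prec_{\mathrm{colex}}r_{i'}$ strictly, or $r_i=r_{i'}$ and $i>i'$. For a matrix $B$ with $s$ rows, $[B]_r$ is the graded matrix with the entries of $B$, row grades $r_i$, and column grades $\bigvee_{B_{ij}\neq0}r_i$ (componentwise maximum). A column $j$ with column grade $c_j$ represents the element $\sum_iB_{ij}M_{r_i\le c_j}(m_i)\in M_{c_j}$. Algorithm Bireduce$(B)$: (i) Set $p\gets0\in\{0,\dots,l\}^s$. For $j=1,\dots,l$: while $i\gets\operatorname{c-piv}(B_j)\neq0$: if $p_i=0$, set $p_i\gets j$ and leave the while loop; otherwise replace $B_j$ by $B_j-(B_{ij}/B_{i,p_i})B_{p_i}$. (ii) Reset $p\gets0$. For $j'=1,\dots,l$: set $j\gets j'$; while $i\gets\operatorname{l-piv}(B_j)\ne0$: if $p_i=0$, set $p_i\gets j$ and leave the while loop; otherwise, if $\operatorname{c-piv}(B_j)$ is smaller than $\operatorname{c-piv}(B_{p_i})$, swap the values of $p_i$ and $j$; then replace $B_j$ by $B_j-(B_{ij}/B_{i,p_i})B_{p_i}$. (iii) Return $[B]_r$. *)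

theory Defs
  imports
    "HOL-Library.Product_Order"
    "HOL-Library.Function_Algebras"
    "Jordan_Normal_Form.Column_Operations"
begin

type_synonym grade = "int \<times> int"

text \<open>
  The order on \<^typ>\<open>grade\<close> is the product order and \<^const>\<open>sup\<close> is the componentwise maximum.

  The components of a persistence module are subspaces of one ambient vector space,
  and the structure maps matter only on these subspaces. This is no restriction, since any
  family of vector spaces embeds into its direct sum.
\<close>

record ('k, 'v) pmod =
  pscale :: "'k \<Rightarrow> 'v \<Rightarrow> 'v"
  pspace :: "grade \<Rightarrow> 'v set"
  pmap :: "grade \<Rightarrow> grade \<Rightarrow> 'v \<Rightarrow> 'v"

definition linear_between ::
  "('k \<Rightarrow> 'a::ab_group_add \<Rightarrow> 'a) \<Rightarrow> 'a set \<Rightarrow> ('k \<Rightarrow> 'b::ab_group_add \<Rightarrow> 'b) \<Rightarrow> 'b set \<Rightarrow> ('a \<Rightarrow> 'b) \<Rightarrow> bool"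
  where
  "linear_between s1 S s2 T f \<longleftrightarrow>
     (\<forall>x\<in>S. f x \<in> T) \<and>
     (\<forall>x\<in>S. \<forall>y\<in>S. f (x + y) = f x + f y) \<and>
     (\<forall>c. \<forall>x\<in>S. f (s1 c x) = s2 c (f x))"

definition persistence_module :: "('k::field, 'v::ab_group_add) pmod \<Rightarrow> bool" where
  "persistence_module M \<longleftrightarrow>
     vector_space (pscale M) \<and>
     (\<forall>z. module.subspace (pscale M) (pspace M z)) \<and>
     (\<forall>z. \<exists>S. finite S \<and> module.span (pscale M) S = pspace M z) \<and>
     (\<forall>z w. z \<le> w \<longrightarrow> linear_between (pscale M) (pspace M z) (pscale M) (pspace M w) (pmap M z w)) \<and>
     (\<forall>z. \<forall>a\<in>pspace M z. pmap M z z a = a) \<and>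
     (\<forall>z w u. z \<le> w \<longrightarrow> w \<le> u \<longrightarrow> (\<forall>a\<in>pspace M z. pmap M w u (pmap M z w a) = pmap M z u a))"

definition pmod_iso ::
  "('k::field, 'a::ab_group_add) pmod \<Rightarrow> ('k, 'b::ab_group_add) pmod \<Rightarrow> (grade \<Rightarrow> 'a \<Rightarrow> 'b) \<Rightarrow> bool"
  where
  "pmod_iso M N f \<longleftrightarrow>
     persistence_module M \<and> persistence_module N \<and>
     (\<forall>z. linear_between (pscale M) (pspace M z) (pscale N) (pspace N z) (f z)) \<and>
     (\<forall>z. bij_betw (f z) (pspace M z) (pspace N z)) \<and>
     (\<forall>z w. z \<le> w \<longrightarrow> (\<forall>a\<in>pspace M z. f w (pmap M z w a) = pmap N z w (f z a)))"


subsection \<open>Free modules and bases\<close>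

text \<open>The component of \<open>free_on z\<close> at \<open>w\<close> is zero unless \<open>z \<le> w\<close>, so the identity is also the correct
  structure map out of a zero component.\<close>

definition free_on :: "grade \<Rightarrow> ('k::field, 'k) pmod" where
  "free_on z = \<lparr> pscale = (*), pspace = (\<lambda>w. if z \<le> w then UNIV else {0}), pmap = (\<lambda>_ _ a. a) \<rparr>"

definition direct_sum ::
  "'i set \<Rightarrow> ('i \<Rightarrow> ('k::field, 'v::ab_group_add) pmod) \<Rightarrow> ('k, 'i \<Rightarrow> 'v) pmod" where
  "direct_sum I N =
     \<lparr> pscale = (\<lambda>c f i. pscale (N i) c (f i)),
       pspace = (\<lambda>z. {f. (\<forall>i\<in>I. f i \<in> pspace (N i) z) \<and> (\<forall>i. i \<notin> I \<longrightarrow> f i = 0) \<and> finite {i. f i \<noteq> 0}}),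
       pmap = (\<lambda>z w f i. if i \<in> I then pmap (N i) z w (f i) else 0) \<rparr>"

text \<open>Countable index sets suffice here: the components of a persistence module are
  finite-dimensional, so only finitely many generators can share a grade.\<close>

definition is_free :: "('k::field, 'v::ab_group_add) pmod \<Rightarrow> bool" where
  "is_free M \<longleftrightarrow> (\<exists>(I :: nat set) g f. pmod_iso (direct_sum I (\<lambda>i. free_on (g i))) M f)"

text \<open>\<open>is_basis M I g m\<close>: the family of elements \<open>m i\<close> of grade \<open>g i\<close> (\<open>i \<in> I\<close>) is a basis of \<open>M\<close>.\<close>

definition is_basis ::
  "('k::field, 'v::ab_group_add) pmod \<Rightarrow> 'i set \<Rightarrow> ('i \<Rightarrow> grade) \<Rightarrow> ('i \<Rightarrow> 'v) \<Rightarrow> bool" where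
  "is_basis M I g m \<longleftrightarrow>
     (\<exists>f. pmod_iso (direct_sum I (\<lambda>i. free_on (g i))) M f \<and>
          (\<forall>i\<in>I. f (g i) (\<lambda>i'. if i' = i then 1 else 0) = m i))"


subsection \<open>Colimits\<close>

text \<open>The index poset is directed, so the colimit consists of the elements of all components,
  where two elements are identified if they become equal in some later component. An element
  of the colimit is an equivalence class.\<close>

definition colim_rel :: "('k, 'v) pmod \<Rightarrow> ((grade \<times> 'v) \<times> (grade \<times> 'v)) set" where
  "colim_rel M = {((z, a), (w, b)). a \<in> pspace M z \<and> b \<in> pspace M w \<and>
     (\<exists>u. z \<le> u \<and> w \<le> u \<and> pmap M z u a = pmap M w u b)}"

definition colim :: "('k, 'v) pmod \<Rightarrow> (grade \<times> 'v) set set" where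
  "colim M = (SIGMA z : UNIV. pspace M z) // colim_rel M"

definition to_colim :: "('k, 'v) pmod \<Rightarrow> grade \<Rightarrow> 'v \<Rightarrow> (grade \<times> 'v) set" where
  "to_colim M z a = colim_rel M `` {(z, a)}"

definition colim_zero :: "('k, 'v::ab_group_add) pmod \<Rightarrow> (grade \<times> 'v) set" where
  "colim_zero M = to_colim M (0, 0) 0"

definition colim_add ::
  "('k, 'v::ab_group_add) pmod \<Rightarrow> (grade \<times> 'v) set \<Rightarrow> (grade \<times> 'v) set \<Rightarrow> (grade \<times> 'v) set" where
  "colim_add M X Y = (THE Z. \<exists>u a b. (u, a) \<in> X \<and> (u, b) \<in> Y \<and> Z = to_colim M u (a + b))"

definition colim_scale ::
  "('k, 'v) pmod \<Rightarrow> 'k \<Rightarrow> (grade \<times> 'v) set \<Rightarrow> (grade \<times> 'v) set" where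
  "colim_scale M c X = (THE Z. \<exists>u a. (u, a) \<in> X \<and> Z = to_colim M u (pscale M c a))"

definition colim_subspace :: "('k, 'v::ab_group_add) pmod \<Rightarrow> (grade \<times> 'v) set set \<Rightarrow> bool" where
  "colim_subspace M V \<longleftrightarrow> V \<subseteq> colim M \<and> colim_zero M \<in> V \<and>
     (\<forall>X\<in>V. \<forall>Y\<in>V. colim_add M X Y \<in> V) \<and> (\<forall>c. \<forall>X\<in>V. colim_scale M c X \<in> V)"

definition colim_span ::
  "('k, 'v::ab_group_add) pmod \<Rightarrow> (grade \<times> 'v) set set \<Rightarrow> (grade \<times> 'v) set set" where
  "colim_span M S = colim_subspace M hull S"

text \<open>The element of the colimit that has coordinates \<open>b\<close> with respect to the images of the
  basis elements \<open>m i\<close>.\<close>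

definition colim_vec ::
  "('k, 'v::ab_group_add) pmod \<Rightarrow> (nat \<Rightarrow> grade) \<Rightarrow> (nat \<Rightarrow> 'v) \<Rightarrow> 'k vec \<Rightarrow> (grade \<times> 'v) set" where
  "colim_vec M r m b =
     foldr (\<lambda>i. colim_add M (colim_scale M (b $ i) (to_colim M (r i) (m i)))) [0..<dim_vec b] (colim_zero M)"

definition bracket :: "('k, 'v) pmod \<Rightarrow> (grade \<times> 'v) set set \<Rightarrow> ('k, 'v) pmod" where
  "bracket M V = M\<lparr> pspace := (\<lambda>z. {a \<in> pspace M z. to_colim M z a \<in> V}) \<rparr>"


subsection \<open>Pivots and graded matrices\<close>

text \<open>Row and column indices start at 0. The pivot of the zero vector is \<^const>\<open>None\<close>, and the array
  \<open>p\<close> of the algorithm is a partial map, \<^const>\<open>None\<close> standing for an unassigned entry.\<close>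

definition lex_le :: "grade \<Rightarrow> grade \<Rightarrow> bool" where
  "lex_le z w \<longleftrightarrow> fst z < fst w \<or> fst z = fst w \<and> snd z \<le> snd w"

definition colex_le :: "grade \<Rightarrow> grade \<Rightarrow> bool" where
  "colex_le z w \<longleftrightarrow> snd z < snd w \<or> snd z = snd w \<and> fst z \<le> fst w"

definition vsupp :: "'k::zero vec \<Rightarrow> nat set" where
  "vsupp b = {i. i < dim_vec b \<and> b $ i \<noteq> 0}"

definition graded_pivot ::
  "(grade \<Rightarrow> grade \<Rightarrow> bool) \<Rightarrow> (nat \<Rightarrow> grade) \<Rightarrow> 'k::zero vec \<Rightarrow> nat option" where
  "graded_pivot R r b =
     (if vsupp b = {} then None
      else Some (LEAST i. i \<in> vsupp b \<and> (\<forall>i'\<in>vsupp b. R (r i') (r i))))"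

abbreviation l_piv :: "(nat \<Rightarrow> grade) \<Rightarrow> 'k::zero vec \<Rightarrow> nat option" where
  "l_piv \<equiv> graded_pivot lex_le"

abbreviation c_piv :: "(nat \<Rightarrow> grade) \<Rightarrow> 'k::zero vec \<Rightarrow> nat option" where
  "c_piv \<equiv> graded_pivot colex_le"

definition c_piv_smaller :: "(nat \<Rightarrow> grade) \<Rightarrow> nat \<Rightarrow> nat \<Rightarrow> bool" where
  "c_piv_smaller r i i' \<longleftrightarrow> colex_le (r i) (r i') \<and> r i \<noteq> r i' \<or> r i = r i' \<and> i > i'"

record 'k graded_mat =
  entries :: "'k mat"
  row_grade :: "nat \<Rightarrow> grade"
  col_grade :: "nat \<Rightarrow> grade"

text \<open>The grade of a zero column is the join of the empty set and hence unspecified.\<close>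

definition graded :: "(nat \<Rightarrow> grade) \<Rightarrow> 'k::zero mat \<Rightarrow> 'k graded_mat" where
  "graded r B = \<lparr> entries = B, row_grade = r, col_grade = (\<lambda>j. Sup_fin (r ` vsupp (col B j))) \<rparr>"

definition nonzero_cols :: "'k::zero graded_mat \<Rightarrow> nat set" where
  "nonzero_cols G = {j. j < dim_col (entries G) \<and> vsupp (col (entries G) j) \<noteq> {}}"

text \<open>If \<open>row_grade G i \<le> col_grade G j\<close> fails, then the entry at \<open>(i, j)\<close> is zero,
  and so is the corresponding summand.\<close>

definition represented ::
  "('k::zero, 'v::ab_group_add) pmod \<Rightarrow> (nat \<Rightarrow> 'v) \<Rightarrow> 'k graded_mat \<Rightarrow> nat \<Rightarrow> 'v" where
  "represented M m G j =
     (\<Sum>i<dim_row (entries G).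
        pscale M (entries G $$ (i, j)) (pmap M (row_grade G i) (col_grade G j) (m i)))"


subsection \<open>The algorithm\<close>

text \<open>Replaces column \<open>j\<close> by \<open>B\<^sub>j - (B\<^sub>i\<^sub>j / B\<^sub>i\<^sub>q) B\<^sub>q\<close>.\<close>

definition eliminate :: "nat \<Rightarrow> nat \<Rightarrow> nat \<Rightarrow> 'k::field mat \<Rightarrow> 'k mat" where
  "eliminate i j q B = addcol (- (B $$ (i, j) / B $$ (i, q))) j q B"

text \<open>The while loops are tail-recursive functions in the option monad, where the result
  \<^const>\<open>None\<close> means that the loop does not terminate.\<close>

partial_function (option) c_loop ::
  "(nat \<Rightarrow> grade) \<Rightarrow> nat \<Rightarrow> 'k::field mat \<times> (nat \<rightharpoonup> nat) \<Rightarrow> ('k mat \<times> (nat \<rightharpoonup> nat)) option" where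
  "c_loop r j Bp = (case Bp of (B, p) \<Rightarrow>
     (case c_piv r (col B j) of
        None \<Rightarrow> Some (B, p)
      | Some i \<Rightarrow>
          (case p i of
             None \<Rightarrow> Some (B, p(i \<mapsto> j))
           | Some q \<Rightarrow> c_loop r j (eliminate i j q B, p))))"

partial_function (option) l_loop ::
  "(nat \<Rightarrow> grade) \<Rightarrow> nat \<Rightarrow> 'k::field mat \<times> (nat \<rightharpoonup> nat) \<Rightarrow> ('k mat \<times> (nat \<rightharpoonup> nat)) option" where
  "l_loop r j Bp = (case Bp of (B, p) \<Rightarrow>
     (case l_piv r (col B j) of
        None \<Rightarrow> Some (B, p)
      | Some i \<Rightarrow>
          (case p i of
             None \<Rightarrow> Some (B, p(i \<mapsto> j))
           | Some q \<Rightarrow>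
               if c_piv_smaller r (the (c_piv r (col B j))) (the (c_piv r (col B q)))
               then l_loop r q (eliminate i q j B, p(i \<mapsto> j))
               else l_loop r j (eliminate i j q B, p))))"

definition for_loop :: "(nat \<Rightarrow> 's \<Rightarrow> 's option) \<Rightarrow> nat \<Rightarrow> 's \<Rightarrow> 's option" where
  "for_loop body l st = fold (\<lambda>j acc. Option.bind acc (body j)) [0..<l] (Some st)"

definition bireduce :: "(nat \<Rightarrow> grade) \<Rightarrow> 'k::field mat \<Rightarrow> 'k graded_mat option" where
  "bireduce r B =
     Option.bind (for_loop (c_loop r) (dim_col B) (B, Map.empty)) (\<lambda>(B', _).
     Option.bind (for_loop (l_loop r) (dim_col B') (B', Map.empty)) (\<lambda>(B'', _).
     Some (graded r B'')))"

end

theory Submission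
  imports Defs
begin

text \<open>
  Bireduction changes neither the column space nor, in its second phase, the colex pivots, so it
  ends with a matrix whose nonzero columns have pairwise distinct lex pivots and pairwise distinct
  colex pivots. In a linear combination of such columns the largest lex pivot and the largest colex
  pivot survive. Hence the columns are independent, and if the combination lies in degree \<open>z\<close>,
  then both coordinates of the grade of every column involved are bounded by those of \<open>z\<close>. So
  the columns of grade at most \<open>z\<close> span the component of \<open>[V]\<^sub>M\<close> at \<open>z\<close>.
\<close>

subsection \<open>Pivots and column operations\<close>

text \<open>Generating V concerns only the colimit, whereas a basis of [V]_M must generate every
  component. The danger is a combination whose rows of large grade cancel: it then exists at grades
  where some column involved does not. A join in two parameters is fixed by two maxima, so one
  distinguished row per coordinate guards against this, and both families of rows must be distinct
  at the same time. The obstacle is that clearing a lex pivot may destroy a colex pivot. The swap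
  answers it by choosing which of two colliding columns is modified; as both have the same lex
  pivot, a measure by lex pivots does not notice the swap. Rows may share a grade, so ties are
  broken by the index, which turns each phase into ordinary elimination along a strict total order
  of the rows. Freeness needs no separate argument, since the reduced matrix supplies the
  basis.\<close>

lemma in_vsupp_iff: "i \<in> vsupp b \<longleftrightarrow> i < dim_vec b \<and> b $ i \<noteq> 0"
  by (simp add: vsupp_def)

lemma finite_vsupp [simp]: "finite (vsupp b)"
  by (simp add: vsupp_def)

text \<open>Lex and colex enter the elimination only as total orders on grades, so the theory of
  pivots is developed once for both.\<close>

locale pivot_order =
  fixes R :: "grade \<Rightarrow> grade \<Rightarrow> bool" and r :: "nat \<Rightarrow> grade"
  assumes R_antisym: "R z w \<Longrightarrow> R w z \<Longrightarrow> z = w"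
    and R_trans: "R z w \<Longrightarrow> R w u \<Longrightarrow> R z u"
    and R_total: "R z w \<or> R w z"
begin

text \<open>On row indices \<open>R\<close> is only a preorder, since rows may share a grade. The
  smaller index counts as the larger row because the pivot is the least index of maximal grade; thus
  the pivot is the greatest element of the support. For colex this is the comparison made by the
  algorithm.\<close>

definition below :: "nat \<Rightarrow> nat \<Rightarrow> bool" where
  "below i i' \<longleftrightarrow> R (r i) (r i') \<and> r i \<noteq> r i' \<or> r i = r i' \<and> i > i'"

lemma R_refl: "R z z"
  using R_total[of z z] by simp

lemma below_irrefl: "\<not> below i i"
  by (simp add: below_def)

lemma below_trans: "below i i' \<Longrightarrow> below i' i'' \<Longrightarrow> below i i''"
  unfolding below_def by (metis R_antisym R_trans less_trans)

lemma below_total: "i = i' \<or> below i i' \<or> below i' i"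
  unfolding below_def by (metis R_total linorder_neqE_nat)

lemma below_imp_R: "i = i' \<or> below i i' \<Longrightarrow> R (r i) (r i')"
  unfolding below_def by (metis R_refl)

lemma ex_greatest:
  assumes "finite A" "A \<noteq> {}"
  shows "\<exists>i\<in>A. \<forall>i'\<in>A. i' = i \<or> below i' i"
  using assms
proof (induction rule: finite_ne_induct)
  case (singleton x)
  then show ?case by simp
next
  case (insert x F)
  then obtain i where i: "i \<in> F" "\<forall>i'\<in>F. i' = i \<or> below i' i" by blast
  show ?case
  proof (cases "below x i")
    case True
    then show ?thesis using i by blast
  next
    case False
    then have "below i x" using below_total[of x i] i insert.hyps by blast
    then have "\<forall>i'\<in>F. below i' x" using i(2) below_trans by metis
    then show ?thesis by blast
  qed
qed

lemma graded_pivot_eq_Some_iff: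
  "graded_pivot R r b = Some i \<longleftrightarrow> i \<in> vsupp b \<and> (\<forall>i'\<in>vsupp b. i' = i \<or> below i' i)"
    (is "_ \<longleftrightarrow> ?top i")
proof -
  have eq: "graded_pivot R r b = Some i" if i: "?top i" for i
  proof -
    have "(LEAST i. i \<in> vsupp b \<and> (\<forall>i'\<in>vsupp b. R (r i') (r i))) = i"
    proof (rule Least_equality)
      show "i \<in> vsupp b \<and> (\<forall>i'\<in>vsupp b. R (r i') (r i))"
        using i below_imp_R by blast
    next
      fix k assume k: "k \<in> vsupp b \<and> (\<forall>i'\<in>vsupp b. R (r i') (r k))"
      then have "R (r i) (r k)" "k = i \<or> below k i" using i by blast+
      then show "i \<le> k" unfolding below_def using R_antisym by fastforce
    qed
    then show ?thesis using i unfolding graded_pivot_def by auto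
  qed
  show ?thesis
  proof
    assume piv: "graded_pivot R r b = Some i"
    then have "vsupp b \<noteq> {}" by (auto simp: graded_pivot_def)
    \<comment> \<open>A greatest element exists, and by \<open>eq\<close> the pivot is that element,
      so it must be \<open>i\<close>.\<close>
    then obtain k where k: "?top k" using ex_greatest[of "vsupp b"] by auto
    with eq[OF k] piv show "?top i" by simp
  qed (rule eq)
qed

lemma graded_pivot_eq_None_iff: "graded_pivot R r b = None \<longleftrightarrow> vsupp b = {}"
  by (simp add: graded_pivot_def)

definition rank :: "nat \<Rightarrow> nat \<Rightarrow> nat" where
  "rank s i = card {i'. i' < s \<and> below i' i}"

lemma rank_less: "below i i' \<Longrightarrow> i < s \<Longrightarrow> rank s i < rank s i'"
  unfolding rank_def
proof (rule psubset_card_mono)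
  assume i: "below i i'" "i < s"
  then have "i \<in> {k. k < s \<and> below k i'}" "i \<notin> {k. k < s \<and> below k i}"
    using below_irrefl by auto
  moreover have "{k. k < s \<and> below k i} \<subseteq> {k. k < s \<and> below k i'}"
    using i below_trans by blast
  ultimately show "{k. k < s \<and> below k i} \<subset> {k. k < s \<and> below k i'}" by blast
qed simp

text \<open>The \<open>Suc\<close> keeps every nonzero vector above the zero vector, so that the
  measure also drops when a column is cancelled completely.\<close>

definition pivot_rank :: "'k::zero vec \<Rightarrow> nat" where
  "pivot_rank b = (case graded_pivot R r b of None \<Rightarrow> 0 | Some i \<Rightarrow> Suc (rank (dim_vec b) i))"

text \<open>Zero columns have no pivot and are unconstrained; dependencies among the input columns
  end up there.\<close>

definition distinct_pivots :: "'k::zero mat \<Rightarrow> bool" where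
  "distinct_pivots B \<longleftrightarrow> (\<forall>j<dim_col B. \<forall>j'<dim_col B. \<forall>i.
     graded_pivot R r (col B j) = Some i \<longrightarrow> graded_pivot R r (col B j') = Some i \<longrightarrow> j = j')"

text \<open>\<open>Q\<close> is the set of settled columns. The equivalence makes \<open>p\<close>
  the inverse of the pivot map on \<open>Q\<close>, and as \<open>p\<close> is single-valued, it
  also says that pivots on \<open>Q\<close> do not repeat.\<close>

definition pivot_table :: "'k::zero mat \<Rightarrow> nat set \<Rightarrow> (nat \<rightharpoonup> nat) \<Rightarrow> bool" where
  "pivot_table B Q p \<longleftrightarrow> (\<forall>i q. p i = Some q \<longleftrightarrow> q \<in> Q \<and> graded_pivot R r (col B q) = Some i)"

lemma pivot_table_distinct:
  "pivot_table B {..<dim_col B} p \<Longrightarrow> distinct_pivots B"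
  unfolding pivot_table_def distinct_pivots_def
  by (metis lessThan_iff option.inject)

lemma pivot_table_cong:
  assumes "pivot_table B Q p" "\<And>q. q \<in> Q \<Longrightarrow> col B' q = col B q"
  shows "pivot_table B' Q p"
  using assms unfolding pivot_table_def by metis

lemma pivot_table_insert_None:
  assumes "pivot_table B (Q - {j}) p" "graded_pivot R r (col B j) = None"
  shows "pivot_table B Q p"
  using assms unfolding pivot_table_def by auto

lemma pivot_table_insert_Some:
  assumes "pivot_table B (Q - {j}) p" "graded_pivot R r (col B j) = Some i" "p i = None" "j \<in> Q"
  shows "pivot_table B Q (p(i \<mapsto> j))"
  using assms unfolding pivot_table_def by (auto split: if_splits) (metis option.inject option.distinct(1))+

text \<open>Columns \<open>j\<close> and \<open>q\<close> compete for the same slot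
  \<open>i\<close>; when \<open>j\<close> takes it over, \<open>q\<close> becomes the one unsettled
  column.\<close>

lemma pivot_table_swap:
  assumes "pivot_table B (Q - {j}) p" "graded_pivot R r (col B j) = Some i" "p i = Some q" "j \<in> Q"
  shows "pivot_table B (Q - {q}) (p(i \<mapsto> j))"
proof -
  have q: "q' = q" if "q' \<in> Q - {j}" "graded_pivot R r (col B q') = Some i" for q'
    using assms(1,3) that unfolding pivot_table_def by (metis option.inject)
  have "q \<in> Q - {j}" "graded_pivot R r (col B q) = Some i"
    using assms(1,3) unfolding pivot_table_def by blast+
  have table: "p k = Some q' \<longleftrightarrow> q' \<in> Q - {j} \<and> graded_pivot R r (col B q') = Some k" for k q'
    using assms(1) unfolding pivot_table_def by blast
  have "(p(i \<mapsto> j)) k = Some q' \<longleftrightarrow> q' \<in> Q - {q} \<and> graded_pivot R r (col B q') = Some k"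
    for k q'
  proof (cases "k = i")
    case True
    then show ?thesis using assms(2,4) q \<open>q \<in> Q - {j}\<close> by auto
  next
    case False
    then have "(p(i \<mapsto> j)) k = Some q' \<longleftrightarrow> q' \<in> Q - {j} \<and> graded_pivot R r (col B q') = Some k"
      using table by simp
    then show ?thesis
      using assms(2) \<open>graded_pivot R r (col B q) = Some i\<close> False by auto
  qed
  then show ?thesis by (simp add: pivot_table_def)
qed

text \<open>The support of \<open>b'\<close> lies strictly below \<open>i\<close>, so entry
  \<open>i\<close> is untouched and no row above it appears.\<close>

lemma graded_pivot_add:
  fixes b b' :: "'k::field vec"
  assumes "graded_pivot R r b = Some i" "graded_pivot R r b' = Some i'" "below i' i"
    and "b \<in> carrier_vec s" "b' \<in> carrier_vec s"
  shows "graded_pivot R r (a \<cdot>\<^sub>v b' + b) = Some i"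
proof -
  have b: "i < s" "b $ i \<noteq> 0" "\<forall>k<s. b $ k \<noteq> 0 \<longrightarrow> k = i \<or> below k i"
    using assms(1,4) unfolding graded_pivot_eq_Some_iff by (auto simp: in_vsupp_iff)
  have b': "\<forall>k<s. b' $ k \<noteq> 0 \<longrightarrow> below k i"
    using assms(2,3,5) below_trans unfolding graded_pivot_eq_Some_iff
    by (metis carrier_vecD in_vsupp_iff)
  then have "b' $ i = 0" using b(1) below_irrefl by blast
  moreover have "\<forall>k<s. a * b' $ k + b $ k \<noteq> 0 \<longrightarrow> k = i \<or> below k i"
    using b(3) b' by (metis add_0 mult_zero_right)
  ultimately show ?thesis
    using b(1,2) assms(4,5) unfolding graded_pivot_eq_Some_iff Ball_def in_vsupp_iff by auto
qed

text \<open>The coefficient kills row \<open>i\<close>, and both supports lie at or below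
  \<open>i\<close>, so whatever survives is strictly below.\<close>

lemma graded_pivot_cancel:
  fixes b b' :: "'k::field vec"
  assumes "graded_pivot R r b = Some i" "graded_pivot R r b' = Some i"
    and "b \<in> carrier_vec s" "b' \<in> carrier_vec s"
    and "graded_pivot R r ((- (b $ i / b' $ i)) \<cdot>\<^sub>v b' + b) = Some k"
  shows "below k i"
proof -
  have b: "i < s" "b' $ i \<noteq> 0" "\<forall>k<s. b $ k \<noteq> 0 \<or> b' $ k \<noteq> 0 \<longrightarrow> k = i \<or> below k i"
    using assms(1-4) unfolding graded_pivot_eq_Some_iff by (auto simp: in_vsupp_iff)
  have k: "k < s" "- (b $ i / b' $ i) * b' $ k + b $ k \<noteq> 0"
    using assms(3-5) unfolding graded_pivot_eq_Some_iff by (auto simp: in_vsupp_iff)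
  then have "k \<noteq> i" using b(2) by auto
  then show ?thesis using k b by auto
qed

end

section \<open>Column spaces under elimination\<close>

definition colspace :: "'k::comm_ring_1 mat \<Rightarrow> 'k vec set" where
  "colspace B = {B *\<^sub>v x | x. x \<in> carrier_vec (dim_col B)}"

lemma colspaceI: "B \<in> carrier_mat s l \<Longrightarrow> x \<in> carrier_vec l \<Longrightarrow> B *\<^sub>v x \<in> colspace B"
  by (auto simp: colspace_def)

lemma colspaceE:
  assumes "B \<in> carrier_mat s l" "b \<in> colspace B"
  obtains x where "x \<in> carrier_vec l" "b = B *\<^sub>v x"
  using assms by (auto simp: colspace_def)

text \<open>A column operation is right multiplication by an elementary matrix, which can be
  absorbed into the coefficient vector.\<close>

lemma colspace_addcol_subset:
  assumes "j < dim_col B" "q < dim_col B" "j \<noteq> q"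
  shows "colspace (addcol a j q B) \<subseteq> colspace B"
proof -
  let ?l = "dim_col B"
  have B: "B \<in> carrier_mat (dim_row B) ?l" by auto
  have eq: "addcol a j q B = B * addrow_mat ?l a q j"
    by (rule addcol_mat[OF B]) (use assms in auto)
  show ?thesis unfolding colspace_def
  proof clarsimp
    fix x :: "'a vec" assume "x \<in> carrier_vec ?l"
    then show "\<exists>x'. addcol a j q B *\<^sub>v x = B *\<^sub>v x' \<and> x' \<in> carrier_vec ?l"
      unfolding eq
      by (intro exI[of _ "addrow_mat ?l a q j *\<^sub>v x"])
         (subst assoc_mult_mat_vec[OF B], auto intro: addrow_mat_carrier mult_mat_vec_carrier)
  qed
qed

lemma colspace_addcol:
  fixes B :: "'k::comm_ring_1 mat"
  assumes "j < dim_col B" "q < dim_col B" "j \<noteq> q"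
  shows "colspace (addcol a j q B) = colspace B"
proof
  \<comment> \<open>The operation is undone by one of the same kind, so the proved inclusion also
    yields the reverse one.\<close>
  have "addcol (- a) j q (addcol a j q B) = B"
    by (rule eq_matI) (use assms in auto)
  then show "colspace B \<subseteq> colspace (addcol a j q B)"
    using colspace_addcol_subset[of j "addcol a j q B" q "- a"] assms by simp
qed (rule colspace_addcol_subset[OF assms])

lemma eliminate_carrier [simp]: "eliminate i j q B \<in> carrier_mat s l \<longleftrightarrow> B \<in> carrier_mat s l"
  unfolding eliminate_def carrier_mat_def by simp

lemma col_eliminate:
  assumes "B \<in> carrier_mat s l" "j < l" "q < l" "i < s"
  shows "col (eliminate i j q B) j = (- (col B j $ i / col B q $ i)) \<cdot>\<^sub>v col B q + col B j"
  using assms unfolding eliminate_def by (subst col_addcol) auto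

lemma col_eliminate_other:
  assumes "k < dim_col B" "k \<noteq> j"
  shows "col (eliminate i j q B) k = col B k"
  unfolding eliminate_def by (rule eq_vecI) (use assms in auto)

lemma colspace_eliminate:
  assumes "B \<in> carrier_mat s l" "j < l" "q < l" "j \<noteq> q"
  shows "colspace (eliminate i j q B) = colspace B"
  unfolding eliminate_def by (rule colspace_addcol) (use assms in auto)

context pivot_order
begin

lemma graded_pivot_row:
  assumes "B \<in> carrier_mat s l" "graded_pivot R r (col B j) = Some i"
  shows "i < s"
  using assms unfolding graded_pivot_eq_Some_iff by (auto simp: in_vsupp_iff)

lemma pivot_rank_eliminate:
  fixes B :: "'k::field mat"
  assumes "B \<in> carrier_mat s l" "j < l" "q < l"
    and "graded_pivot R r (col B j) = Some i" "graded_pivot R r (col B q) = Some i"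
  shows "pivot_rank (col (eliminate i j q B) j) < pivot_rank (col B j)"
proof -
  have i: "i < s" using graded_pivot_row assms by blast
  have "below k i \<and> k < s" if "graded_pivot R r (col (eliminate i j q B) j) = Some k" for k
    using graded_pivot_cancel[OF assms(4,5), of s k] that assms(1-3) i
      graded_pivot_row[of "eliminate i j q B" s l j k] by (auto simp: col_eliminate)
  moreover have "dim_row (eliminate i j q B) = s" using assms(1) by (simp add: eliminate_def)
  ultimately show ?thesis
    using assms(1,4) rank_less unfolding pivot_rank_def by (auto split: option.splits)
qed

text \<open>The cleared row \<open>i\<close> need not be an \<open>R\<close>-pivot. In the second
  phase it is a lex pivot, while \<open>R\<close> is colex.\<close>

lemma graded_pivot_eliminate:
  fixes B :: "'k::field mat"
  assumes "B \<in> carrier_mat s l" "j < l" "q < l" "k < l" "i < s"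
    and "graded_pivot R r (col B j) = Some a" "graded_pivot R r (col B q) = Some b" "below b a"
  shows "graded_pivot R r (col (eliminate i j q B) k) = graded_pivot R r (col B k)"
proof (cases "k = j")
  case True
  then show ?thesis
    using graded_pivot_add[OF assms(6-8), of s] assms by (auto simp: col_eliminate)
next
  case False
  then show ?thesis using assms by (simp add: col_eliminate_other)
qed

text \<open>The largest pivot among the columns used in a combination cannot be cancelled by the others.\<close>

lemma distinct_pivots_dominate:
  fixes B :: "'k::field mat"
  assumes B: "B \<in> carrier_mat s l" and "distinct_pivots B" and x: "x \<in> carrier_vec l"
    and j: "j < l" "x $ j \<noteq> 0" and piv: "graded_pivot R r (col B j) = Some i"
  shows "\<exists>k\<in>vsupp (B *\<^sub>v x). R (r i) (r k)"
proof -
  \<comment> \<open>The pivot rows of all columns that really occur; its greatest element is the row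
    \<open>k\<close> that survives.\<close>
  define A where "A = {k. \<exists>j<l. x $ j \<noteq> 0 \<and> graded_pivot R r (col B j) = Some k}"
  have "A \<subseteq> {..<s}" using graded_pivot_row[OF B] by (auto simp: A_def)
  then have "finite A" using finite_subset by blast
  moreover have "i \<in> A" using j piv by (auto simp: A_def)
  ultimately obtain k where k: "k \<in> A" "\<forall>k'\<in>A. k' = k \<or> below k' k"
    using ex_greatest by blast
  obtain q where q: "q < l" "x $ q \<noteq> 0" "graded_pivot R r (col B q) = Some k"
    using k(1) by (auto simp: A_def)
  have ks: "k < s" using graded_pivot_row[OF B q(3)] .
  have nz: "B $$ (k, q) \<noteq> 0"
    using q ks B unfolding graded_pivot_eq_Some_iff by (auto simp: in_vsupp_iff)
  \<comment> \<open>A further column contributing to row \<open>k\<close> would have its pivot at or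
    above \<open>k\<close>, hence equal to \<open>k\<close> by maximality, against
    distinctness.\<close>
  have zero: "B $$ (k, j') * x $ j' = 0" if "j' < l" "j' \<noteq> q" for j'
  proof (rule ccontr)
    assume "B $$ (k, j') * x $ j' \<noteq> 0"
    then have kj': "k \<in> vsupp (col B j')" "x $ j' \<noteq> 0"
      using that ks B by (auto simp: in_vsupp_iff)
    then obtain k' where k': "graded_pivot R r (col B j') = Some k'"
      using graded_pivot_eq_None_iff by (cases "graded_pivot R r (col B j')") auto
    then have "k' \<in> A" using kj' that by (auto simp: A_def)
    moreover have "k = k' \<or> below k k'"
      using k' kj'(1) unfolding graded_pivot_eq_Some_iff by blast
    ultimately have "k = k'" using k(2) below_trans below_irrefl by metis
    then show False
      using assms(2) k' q that B unfolding distinct_pivots_def by auto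
  qed
  have "(B *\<^sub>v x) $ k = (\<Sum>j'<l. B $$ (k, j') * x $ j')"
    using B x ks by (auto simp: scalar_prod_def atLeast0LessThan intro!: sum.cong)
  also have "\<dots> = B $$ (k, q) * x $ q"
    using q(1) zero by (subst sum.remove[of _ q]) (auto intro!: sum.neutral simp del: mult_eq_0_iff)
  finally have "k \<in> vsupp (B *\<^sub>v x)"
    using nz q(2) ks B by (simp add: in_vsupp_iff)
  moreover have "R (r i) (r k)" using k(2) \<open>i \<in> A\<close> below_imp_R by blast
  ultimately show ?thesis by blast
qed

end

interpretation lex: pivot_order lex_le r for r
  by unfold_locales (auto simp: lex_le_def prod_eq_iff)

interpretation colex: pivot_order colex_le r for r
  by unfold_locales (auto simp: colex_le_def prod_eq_iff)

lemma c_piv_smaller_eq_below: "c_piv_smaller r = colex.below r"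
  by (intro ext) (simp add: c_piv_smaller_def colex.below_def)

subsection \<open>Bireduction\<close>

text \<open>Before the exit only column \<open>j\<close> changes, and it lies outside the table's
  domain \<open>Q - {j}\<close>; so \<open>p\<close> stays valid and fixed while the rank of the
  pivot of column \<open>j\<close> falls.\<close>

lemma c_loop_terminates:
  fixes B :: "'k::field mat"
  assumes "B \<in> carrier_mat s l" "j \<in> Q" "Q \<subseteq> {..<l}" "colex.pivot_table r B (Q - {j}) p"
  shows "\<exists>B' p'. c_loop r j (B, p) = Some (B', p') \<and> B' \<in> carrier_mat s l \<and>
           colspace B' = colspace B \<and> colex.pivot_table r B' Q p'"
  using assms
proof (induction "colex.pivot_rank r (col B j)" arbitrary: B rule: less_induct)
  case less
  show ?case
  proof (cases "c_piv r (col B j)")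
    case None
    then have "c_loop r j (B, p) = Some (B, p)" by (subst c_loop.simps) simp
    then show ?thesis using less.prems colex.pivot_table_insert_None[OF _ None] by blast
  next
    case (Some i)
    show ?thesis
    proof (cases "p i")
      case None
      then have "c_loop r j (B, p) = Some (B, p(i \<mapsto> j))"
        using Some by (subst c_loop.simps) simp
      then show ?thesis
        using less.prems colex.pivot_table_insert_Some[of r B Q j p i] Some None by blast
    next
      case p: (Some q)
      let ?B = "eliminate i j q B"
      have loop: "c_loop r j (B, p) = c_loop r j (?B, p)"
        using Some p by (subst c_loop.simps) simp
      have q: "q \<in> Q" "q \<noteq> j" "c_piv r (col B q) = Some i"
        using less.prems(4) p unfolding colex.pivot_table_def by auto
      have jq: "j < l" "q < l" using q less.prems by auto
      have "colex.pivot_table r ?B (Q - {j}) p"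
        by (rule colex.pivot_table_cong[OF less.prems(4)])
           (use less.prems in \<open>auto intro!: col_eliminate_other\<close>)
      with less.hyps[of ?B] colex.pivot_rank_eliminate[OF less.prems(1) jq Some q(3)]
      show ?thesis
        unfolding loop using less.prems colspace_eliminate[OF less.prems(1) jq] q(2) by simp
    qed
  qed
qed

text \<open>A column is only ever changed by one with a smaller colex pivot, hence all colex pivots persist.\<close>

lemma l_loop_terminates:
  fixes B :: "'k::field mat"
  assumes "B \<in> carrier_mat s l" "j \<in> Q" "Q \<subseteq> {..<l}" "lex.pivot_table r B (Q - {j}) p"
    and "colex.distinct_pivots r B"
  shows "\<exists>B' p'. l_loop r j (B, p) = Some (B', p') \<and> B' \<in> carrier_mat s l \<and>
           colspace B' = colspace B \<and> lex.pivot_table r B' Q p' \<and> colex.distinct_pivots r B'"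
  using assms
proof (induction "lex.pivot_rank r (col B j)" arbitrary: B j p rule: less_induct)
  case less
  show ?case
  proof (cases "l_piv r (col B j)")
    case None
    then have "l_loop r j (B, p) = Some (B, p)" by (subst l_loop.simps) simp
    then show ?thesis using less.prems lex.pivot_table_insert_None[OF _ None] by blast
  next
    case (Some i)
    show ?thesis
    proof (cases "p i")
      case None
      then have "l_loop r j (B, p) = Some (B, p(i \<mapsto> j))"
        using Some by (subst l_loop.simps) simp
      then show ?thesis
        using less.prems lex.pivot_table_insert_Some[of r B Q j p i] Some None by blast
    next
      case p: (Some q)
      have q: "q \<in> Q" "q \<noteq> j" "l_piv r (col B q) = Some i"
        using less.prems(4) p unfolding lex.pivot_table_def by auto
      have jq: "j < l" "q < l" using q less.prems by auto
      have i: "i < s" using lex.graded_pivot_row[OF less.prems(1) Some] .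
      have "vsupp (col B j) \<noteq> {}" "vsupp (col B q) \<noteq> {}"
        using Some q(3) unfolding lex.graded_pivot_eq_Some_iff by auto
      then obtain a b where ab: "c_piv r (col B j) = Some a" "c_piv r (col B q) = Some b"
        \<comment> \<open>Both columns are nonzero, so the two uses of \<open>the\<close> in
          \<open>l_loop\<close> are well defined.\<close>
        by (metis colex.graded_pivot_eq_None_iff not_Some_eq)
      \<comment> \<open>Distinct colex pivots rule out a tie, so in both branches the modified
        column has the strictly larger colex pivot.\<close>
      have "a \<noteq> b"
        using less.prems(1,5) ab jq q(2) unfolding colex.distinct_pivots_def by auto
      have step: "colex.distinct_pivots r (eliminate i j' q' B)"
        if "j' < l" "q' < l" "c_piv r (col B j') = Some a'" "c_piv r (col B q') = Some b'"
          "colex.below r b' a'" for j' q' a' b'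
      proof -
        have "c_piv r (col (eliminate i j' q' B) k) = c_piv r (col B k)" if "k < l" for k
          using colex.graded_pivot_eliminate[OF less.prems(1) \<open>j' < l\<close> \<open>q' < l\<close> that i] that
            \<open>c_piv r (col B j') = Some a'\<close> \<open>c_piv r (col B q') = Some b'\<close>
            \<open>colex.below r b' a'\<close> by blast
        moreover have "dim_col (eliminate i j' q' B) = l" "dim_col B = l"
          using less.prems(1) by (auto simp: eliminate_def)
        ultimately show ?thesis
          using less.prems(5) unfolding colex.distinct_pivots_def by metis
      qed
      have table: "lex.pivot_table r (eliminate i j' q' B) (Q - {j'}) p'"
        if "lex.pivot_table r B (Q - {j'}) p'" for j' q' p'
        by (rule lex.pivot_table_cong[OF that])
           (use less.prems in \<open>auto intro!: col_eliminate_other\<close>)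
      show ?thesis
      proof (cases "colex.below r a b")
        case True
        let ?B = "eliminate i q j B"
        have loop: "l_loop r j (B, p) = l_loop r q (?B, p(i \<mapsto> j))"
          using Some p ab True by (subst l_loop.simps) (simp add: c_piv_smaller_eq_below)
        have "lex.pivot_table r ?B (Q - {q}) (p(i \<mapsto> j))"
          using table lex.pivot_table_swap[OF less.prems(4) Some p less.prems(2)] .
        \<comment> \<open>Before the elimination columns \<open>q\<close> and \<open>j\<close> have
          the same lex pivot and hence equal rank, so the measure drops although the current column
          has changed.\<close>
        moreover have "lex.pivot_rank r (col ?B q) < lex.pivot_rank r (col B j)"
          using lex.pivot_rank_eliminate[OF less.prems(1) jq(2,1) q(3) Some] Some q(3) less.prems(1)
          by (simp add: lex.pivot_rank_def)
        ultimately show ?thesis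
          using less.hyps[of ?B q "p(i \<mapsto> j)"] q step[OF jq(2,1) ab(2,1) True] less.prems(1,3)
            colspace_eliminate[OF less.prems(1) jq(2,1)] unfolding loop by simp
      next
        case False
        then have below: "colex.below r b a" using \<open>a \<noteq> b\<close> colex.below_total by blast
        let ?B = "eliminate i j q B"
        have loop: "l_loop r j (B, p) = l_loop r j (?B, p)"
          using Some p ab False by (subst l_loop.simps) (simp add: c_piv_smaller_eq_below)
        have "lex.pivot_table r ?B (Q - {j}) p"
          using table less.prems(4) .
        moreover have "lex.pivot_rank r (col ?B j) < lex.pivot_rank r (col B j)"
          using lex.pivot_rank_eliminate[OF less.prems(1) jq Some q(3)] .
        ultimately show ?thesis
          using less.hyps[of ?B j p] q step[OF jq ab below] less.prems(1-3)
            colspace_eliminate[OF less.prems(1) jq] unfolding loop by simp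
      qed
    qed
  qed
qed

lemma for_loop_invariant:
  assumes "I 0 st"
    and "\<And>j st. j < l \<Longrightarrow> I j st \<Longrightarrow> \<exists>st'. body j st = Some st' \<and> I (Suc j) st'"
  shows "\<exists>st'. for_loop body l st = Some st' \<and> I l st'"
  using assms(2)
proof (induction l)
  case 0
  then show ?case using assms(1) by (simp add: for_loop_def)
next
  case (Suc l)
  then obtain st' where st': "for_loop body l st = Some st'" "I l st'" by (metis less_SucI)
  with Suc.prems[of l st'] show ?case by (simp add: for_loop_def)
qed

lemma bireduce_terminates:
  fixes B :: "'k::field mat"
  assumes B: "B \<in> carrier_mat s l"
  obtains B' where "bireduce r B = Some (graded r B')" "B' \<in> carrier_mat s l"
    "colspace B' = colspace B" "lex.distinct_pivots r B'" "colex.distinct_pivots r B'"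
proof -
  define I where "I j = (\<lambda>(B', p). B' \<in> carrier_mat s l \<and> colspace B' = colspace B \<and>
    colex.pivot_table r B' {..<j} p)" for j
  have "\<exists>st. for_loop (c_loop r) l (B, Map.empty) = Some st \<and> I l st"
  proof (rule for_loop_invariant)
    show "I 0 (B, Map.empty)" using B by (simp add: I_def colex.pivot_table_def)
    fix j st assume j: "j < l" and "I j st"
    then obtain B1 p where st: "st = (B1, p)" and B1: "B1 \<in> carrier_mat s l"
      "colspace B1 = colspace B" "colex.pivot_table r B1 {..<j} p" by (auto simp: I_def)
    have "{..<Suc j} - {j} = {..<j}" by auto
    then have "\<exists>B' p'. c_loop r j (B1, p) = Some (B', p') \<and> B' \<in> carrier_mat s l \<and>
           colspace B' = colspace B1 \<and> colex.pivot_table r B' {..<Suc j} p'"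
      using B1 j by (intro c_loop_terminates) auto
    then show "\<exists>st'. c_loop r j st = Some st' \<and> I (Suc j) st'"
      using B1 unfolding st I_def by auto
  qed
  then obtain B1 p where loop1: "for_loop (c_loop r) l (B, Map.empty) = Some (B1, p)"
    and B1: "B1 \<in> carrier_mat s l" "colspace B1 = colspace B" "colex.pivot_table r B1 {..<l} p"
    by (auto simp: I_def)
  have distinct: "colex.distinct_pivots r B1"
    using B1 colex.pivot_table_distinct[of r B1 p] by simp
  \<comment> \<open>The table is reset; the first phase is remembered only through the distinctness
    of the colex pivots.\<close>
  define J where "J j = (\<lambda>(B', p). B' \<in> carrier_mat s l \<and> colspace B' = colspace B \<and>
    lex.pivot_table r B' {..<j} p \<and> colex.distinct_pivots r B')" for j
  have "\<exists>st. for_loop (l_loop r) l (B1, Map.empty) = Some st \<and> J l st"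
  proof (rule for_loop_invariant)
    show "J 0 (B1, Map.empty)" using B1 distinct by (simp add: J_def lex.pivot_table_def)
    fix j st assume j: "j < l" and "J j st"
    then obtain B2 p where st: "st = (B2, p)" and B2: "B2 \<in> carrier_mat s l"
      "colspace B2 = colspace B" "lex.pivot_table r B2 {..<j} p" "colex.distinct_pivots r B2"
      by (auto simp: J_def)
    have "{..<Suc j} - {j} = {..<j}" by auto
    then have "\<exists>B' p'. l_loop r j (B2, p) = Some (B', p') \<and> B' \<in> carrier_mat s l \<and>
           colspace B' = colspace B2 \<and> lex.pivot_table r B' {..<Suc j} p' \<and>
           colex.distinct_pivots r B'"
      using B2 j by (intro l_loop_terminates) auto
    then show "\<exists>st'. l_loop r j st = Some st' \<and> J (Suc j) st'"
      using B2 unfolding st J_def by auto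
  qed
  then obtain B2 p' where loop2: "for_loop (l_loop r) l (B1, Map.empty) = Some (B2, p')"
    and B2: "B2 \<in> carrier_mat s l" "colspace B2 = colspace B" "lex.pivot_table r B2 {..<l} p'"
      "colex.distinct_pivots r B2"
    by (auto simp: J_def)
  have "bireduce r B = Some (graded r B2)"
    using loop1 loop2 B B1(1) by (simp add: bireduce_def)
  moreover have "lex.distinct_pivots r B2"
    using B2 lex.pivot_table_distinct[of r B2 p'] by simp
  ultimately show thesis using that B2 by blast
qed

subsection \<open>Free modules in coordinates\<close>

lemma sum_fun_apply: "(\<Sum>i\<in>A. f i) x = (\<Sum>i\<in>A. f i x)"
  by (induction A rule: infinite_finite_induct) auto

lemma vector_space_fun: "vector_space (\<lambda>c (f :: 'i \<Rightarrow> 'k::field) i. c * f i)"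
  by unfold_locales (auto simp: fun_eq_iff algebra_simps)

lemma pspace_direct_sum_free:
  assumes "finite J"
  shows "pspace (direct_sum J (\<lambda>j. free_on (g j))) z = {f. \<forall>j. f j \<noteq> 0 \<longrightarrow> j \<in> J \<and> g j \<le> z}"
    (is "?L = ?R")
proof
  show "?L \<subseteq> ?R" by (auto simp: direct_sum_def free_on_def split: if_splits)
  show "?R \<subseteq> ?L"
  proof
    fix f assume f: "f \<in> ?R"
    then have "{j. f j \<noteq> 0} \<subseteq> J" by auto
    then have "finite {j. f j \<noteq> 0}" using assms finite_subset by blast
    then show "f \<in> ?L" using f by (auto simp: direct_sum_def free_on_def)
  qed
qed

lemma pscale_direct_sum_free:
  "pscale (direct_sum J (\<lambda>j. free_on (g j))) = (\<lambda>c f j. c * f j)"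
  by (simp add: direct_sum_def free_on_def)

lemma pmap_direct_sum_free:
  assumes "finite J" "f \<in> pspace (direct_sum J (\<lambda>j. free_on (g j))) z"
  shows "pmap (direct_sum J (\<lambda>j. free_on (g j))) u w f = f"
proof
  show "pmap (direct_sum J (\<lambda>j. free_on (g j))) u w f i = f i" for i
    using assms(2) unfolding pspace_direct_sum_free[OF assms(1)]
    by (cases "f i = 0") (auto simp: direct_sum_def free_on_def)
qed

lemma persistence_module_direct_sum_free:
  fixes g :: "'i \<Rightarrow> grade"
  assumes J: "finite J"
  shows "persistence_module (direct_sum J (\<lambda>j. free_on (g j)) :: ('k::field, 'i \<Rightarrow> 'k) pmod)"
    (is "persistence_module ?D")
proof -
  let ?sc = "\<lambda>c (f :: 'i \<Rightarrow> 'k) i. c * f i"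
  interpret F: vector_space ?sc by (rule vector_space_fun)
  note space = pspace_direct_sum_free[OF J]
  have subspace: "F.subspace (pspace ?D z)" for z
    unfolding F.subspace_def space by (auto intro: add.left_neutral)
       (metis add.right_neutral)+
  have "\<exists>S. finite S \<and> F.span S = pspace ?D z" for z
  proof -
    define \<delta> :: "'i \<Rightarrow> 'i \<Rightarrow> 'k" where "\<delta> j = (\<lambda>i. if i = j then 1 else 0)" for j
    \<comment> \<open>The generators already born at \<open>z\<close>.\<close>
    let ?S = "\<delta> ` {j \<in> J. g j \<le> z}"
    have "F.span ?S \<subseteq> pspace ?D z"
      using subspace by (intro F.span_minimal) (auto simp: space \<delta>_def split: if_splits)
    moreover have "f \<in> F.span ?S" if f: "f \<in> pspace ?D z" for f
    proof -
      have "f = (\<Sum>j\<in>{j \<in> J. g j \<le> z}. ?sc (f j) (\<delta> j))"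
      proof
        fix i
        show "f i = (\<Sum>j\<in>{j \<in> J. g j \<le> z}. ?sc (f j) (\<delta> j)) i"
          using f J by (auto simp: sum_fun_apply \<delta>_def space if_distrib cong: if_cong)
      qed
      also have "\<dots> \<in> F.span ?S"
        by (intro F.span_sum F.span_scale F.span_base) auto
      finally show ?thesis .
    qed
    ultimately have "F.span ?S = pspace ?D z" by blast
    then show ?thesis using J by (intro exI[of _ ?S]) auto
  qed
  moreover have "linear_between ?sc (pspace ?D z) ?sc (pspace ?D w) (pmap ?D z w)"
    if "z \<le> w" for z w
  proof -
    have "x \<in> pspace ?D w" if "x \<in> pspace ?D z" for x
      using that \<open>z \<le> w\<close> unfolding space by (auto intro: order_trans)
    then show ?thesis
      using F.subspace_add[OF subspace, of _ z] F.subspace_scale[OF subspace, of _ z]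
        pmap_direct_sum_free[OF J, of _ g z]
      unfolding linear_between_def by metis
  qed
  ultimately show ?thesis
    unfolding persistence_module_def pscale_direct_sum_free
    using vector_space_fun subspace by (simp add: pmap_direct_sum_free[OF J])
qed

lemma mult_mat_unit_vec:
  fixes A :: "'k::semiring_1 mat"
  assumes "A \<in> carrier_mat nr nc" "j < nc"
  shows "A *\<^sub>v unit_vec nc j = col A j"
  using assms by (intro eq_vecI) auto

section \<open>Free modules as spaces of coordinate vectors\<close>

definition supported :: "(nat \<Rightarrow> grade) \<Rightarrow> nat \<Rightarrow> grade \<Rightarrow> 'k::zero vec set" where
  "supported r s z = {b \<in> carrier_vec s. \<forall>i<s. b $ i \<noteq> 0 \<longrightarrow> r i \<le> z}"

lemma supported_carrier: "b \<in> supported r s z \<Longrightarrow> b \<in> carrier_vec s"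
  by (simp add: supported_def)

lemma supported_mono: "b \<in> supported r s z \<Longrightarrow> z \<le> w \<Longrightarrow> b \<in> supported r s w"
  unfolding supported_def by (auto intro: order_trans)

lemma supported_zero: "0\<^sub>v s \<in> supported r s z"
  by (simp add: supported_def)

lemma supported_add:
  fixes b b' :: "'k::field vec"
  shows "b \<in> supported r s z \<Longrightarrow> b' \<in> supported r s z \<Longrightarrow> b + b' \<in> supported r s z"
  unfolding supported_def by auto

lemma supported_smult:
  fixes b :: "'k::field vec"
  shows "b \<in> supported r s z \<Longrightarrow> c \<cdot>\<^sub>v b \<in> supported r s z"
  unfolding supported_def by auto

text \<open>A join of the finitely many row grades works. At such a grade every coordinate vector
  has a representative, so finitely many colimit elements can be compared in one component.\<close>

lemma ex_supported_carrier: "\<exists>u. carrier_vec s \<subseteq> (supported r s u :: 'k::zero vec set)"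
proof -
  have "\<exists>u. \<forall>i<s. r i \<le> u"
  proof (induction s)
    case (Suc s)
    then obtain u where "\<forall>i<s. r i \<le> u" by blast
    then have "\<forall>i<Suc s. r i \<le> sup u (r s)"
      by (metis le_supI1 less_Suc_eq sup.cobounded2)
    then show ?case by blast
  qed simp
  then show ?thesis by (auto simp: supported_def)
qed

text \<open>A basis of \<open>M\<close>, encoded as compatible coordinate isomorphisms \<open>\<psi> z\<close> from the vectors
  supported in grades below \<open>z\<close>. The structure maps become inclusions of coordinate vectors.\<close>

locale coordinates =
  fixes M :: "('k::field, 'v::ab_group_add) pmod"
    and s :: nat and r :: "nat \<Rightarrow> grade" and \<psi> :: "grade \<Rightarrow> 'k vec \<Rightarrow> 'v"
  assumes module: "persistence_module M"
    and bij: "bij_betw (\<psi> z) (supported r s z) (pspace M z)"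
    and add: "b \<in> supported r s z \<Longrightarrow> b' \<in> supported r s z \<Longrightarrow> \<psi> z (b + b') = \<psi> z b + \<psi> z b'"
    and scale: "b \<in> supported r s z \<Longrightarrow> \<psi> z (c \<cdot>\<^sub>v b) = pscale M c (\<psi> z b)"
    and map: "z \<le> w \<Longrightarrow> b \<in> supported r s z \<Longrightarrow> pmap M z w (\<psi> z b) = \<psi> w b"
begin

lemma inj: "b \<in> supported r s z \<Longrightarrow> b' \<in> supported r s z \<Longrightarrow> \<psi> z b = \<psi> z b' \<longleftrightarrow> b = b'"
  using bij[of z] by (auto simp: bij_betw_def inj_on_def)

lemma pspace_eq: "pspace M z = \<psi> z ` supported r s z"
  using bij[of z] by (simp add: bij_betw_def)

lemma zero: "\<psi> z (0\<^sub>v s) = 0"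
  using add[OF supported_zero supported_zero, of z] by simp

lemma basis_expansion:
  assumes b: "b \<in> supported r s z"
  shows "\<psi> z b = (\<Sum>i<s. pscale M (b $ i) (pmap M (r i) z (\<psi> (r i) (unit_vec s i))))"
proof -
  interpret vector_space "pscale M" using module by (simp add: persistence_module_def)
  let ?b = "\<lambda>n. vec s (\<lambda>i. if i < n then b $ i else 0)"
  have partial: "\<psi> z (?b n) = (\<Sum>i<n. pscale M (b $ i) (pmap M (r i) z (\<psi> (r i) (unit_vec s i))))"
    if "n \<le> s" for n
    using that
  proof (induction n)
    case 0
    have "?b 0 = 0\<^sub>v s" by auto
    then show ?case by (simp add: zero)
  next
    case (Suc n)
    have b_n: "?b n \<in> supported r s z" using b by (auto simp: supported_def)
    have sum: "?b (Suc n) = ?b n + b $ n \<cdot>\<^sub>v unit_vec s n"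
      using Suc.prems by (intro eq_vecI) (auto simp: less_Suc_eq)
    show ?case
    \<comment> \<open>If the entry vanishes, \<open>r n\<close> may fail to be below
      \<open>z\<close>, and nothing is known about the structure map; the zero scalar removes the
      summand.\<close>
    proof (cases "b $ n = 0")
      case True
      then have "?b (Suc n) = ?b n" using sum Suc.prems by (intro eq_vecI) (auto simp: less_Suc_eq)
      then show ?thesis using Suc True by simp
    next
      case False
      have "r n \<le> z" using False b Suc.prems by (auto simp: supported_def)
      moreover have u: "unit_vec s n \<in> supported r s (r n)" by (auto simp: supported_def unit_vec_def)
      ultimately have "\<psi> z (?b (Suc n)) = \<psi> z (?b n) +
          pscale M (b $ n) (pmap M (r n) z (\<psi> (r n) (unit_vec s n)))"
        unfolding sum by (simp add: add scale map b_n supported_smult supported_mono[OF u])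
      then show ?thesis using Suc by simp
    qed
  qed
  have "?b s = b" using b by (auto simp: supported_def)
  then show ?thesis using partial[OF order_refl] by metis
qed

section \<open>The colimit in coordinates\<close>

definition colim_class :: "'k vec \<Rightarrow> (grade \<times> 'v) set" where
  "colim_class b = {(w, a). b \<in> supported r s w \<and> a = \<psi> w b}"

text \<open>Structure maps act as inclusions of coordinate vectors, so two elements become equal
  later exactly if their coordinates already agree.\<close>

lemma to_colim_eq:
  assumes b: "b \<in> supported r s z"
  shows "to_colim M z (\<psi> z b) = colim_class b"
proof -
  have "(\<exists>u. z \<le> u \<and> w \<le> u \<and> pmap M z u (\<psi> z b) = pmap M w u (\<psi> w b')) \<longleftrightarrow> b = b'"
    if b': "b' \<in> supported r s w" for w b'
  proof
    assume "\<exists>u. z \<le> u \<and> w \<le> u \<and> pmap M z u (\<psi> z b) = pmap M w u (\<psi> w b')"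
    then obtain u where u: "z \<le> u" "w \<le> u" "\<psi> u b = \<psi> u b'"
      using b b' map by metis
    then show "b = b'" using inj supported_mono[OF b u(1)] supported_mono[OF b' u(2)] by blast
  next
    assume "b = b'"
    then show "\<exists>u. z \<le> u \<and> w \<le> u \<and> pmap M z u (\<psi> z b) = pmap M w u (\<psi> w b')"
      using b b' by (intro exI[of _ "sup z w"]) (simp add: map)
  qed
  note same = this
  have "(w, a) \<in> to_colim M z (\<psi> z b) \<longleftrightarrow> (w, a) \<in> colim_class b" for w a
  proof (cases "a \<in> pspace M w")
    case True
    then obtain b' where b': "b' \<in> supported r s w" "a = \<psi> w b'" using pspace_eq by blast
    have "\<psi> z b \<in> pspace M z" using b pspace_eq by blast
    then have "(w, a) \<in> to_colim M z (\<psi> z b) \<longleftrightarrow> b = b'"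
      using True same[OF b'(1)] by (simp add: to_colim_def colim_rel_def b'(2))
    then show ?thesis using b' inj[OF b'(1), of b] by (auto simp: colim_class_def)
  next
    case False
    then show ?thesis by (auto simp: to_colim_def colim_rel_def colim_class_def pspace_eq)
  qed
  then show ?thesis by auto
qed

lemma colim_class_inj:
  assumes "b \<in> carrier_vec s" "b' \<in> carrier_vec s" "colim_class b = colim_class b'"
  shows "b = b'"
proof -
  obtain u where "carrier_vec s \<subseteq> (supported r s u :: 'k vec set)" using ex_supported_carrier by blast
  then have "(u, \<psi> u b) \<in> colim_class b" "b \<in> supported r s u" "b' \<in> supported r s u"
    using assms by (auto simp: colim_class_def)
  then have "(u, \<psi> u b) \<in> colim_class b'" using assms(3) by simp
  then have "\<psi> u b = \<psi> u b'" by (simp add: colim_class_def)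
  then show ?thesis using inj \<open>b \<in> supported r s u\<close> \<open>b' \<in> supported r s u\<close> by blast
qed

lemma colim_class_in_colim: "b \<in> carrier_vec s \<Longrightarrow> colim_class b \<in> colim M"
proof -
  assume b: "b \<in> carrier_vec s"
  obtain u where "carrier_vec s \<subseteq> (supported r s u :: 'k vec set)" using ex_supported_carrier by blast
  then have u: "b \<in> supported r s u" using b by blast
  have "to_colim M u (\<psi> u b) \<in> colim M"
    unfolding to_colim_def colim_def using u by (intro quotientI) (auto simp: pspace_eq)
  then show ?thesis using to_colim_eq[OF u] by simp
qed

lemma colim_zero_eq: "colim_zero M = colim_class (0\<^sub>v s)"
  using to_colim_eq[OF supported_zero, of "(0, 0)"] unfolding colim_zero_def zero .

text \<open>The definite description needs a common component, provided by a large \<open>u\<close>,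
  and independence of the representatives, which holds because each component contains at most one
  representative of a class.\<close>

lemma colim_add_eq:
  assumes "b \<in> carrier_vec s" "b' \<in> carrier_vec s"
  shows "colim_add M (colim_class b) (colim_class b') = colim_class (b + b')"
  unfolding colim_add_def
proof (rule the_equality)
  obtain u where "carrier_vec s \<subseteq> (supported r s u :: 'k vec set)" using ex_supported_carrier by blast
  then have u: "b \<in> supported r s u" "b' \<in> supported r s u" using assms by auto
  show "\<exists>u a a'. (u, a) \<in> colim_class b \<and> (u, a') \<in> colim_class b' \<and>
      colim_class (b + b') = to_colim M u (a + a')"
    using u to_colim_eq[OF supported_add[OF u]]
    by (intro exI[of _ u] exI[of _ "\<psi> u b"] exI[of _ "\<psi> u b'"]) (simp add: colim_class_def add)
next
  fix Z assume "\<exists>u a a'. (u, a) \<in> colim_class b \<and> (u, a') \<in> colim_class b' \<and> Z = to_colim M u (a + a')"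
  then show "Z = colim_class (b + b')"
    using to_colim_eq[OF supported_add] by (auto simp: colim_class_def add[symmetric])
qed

lemma colim_scale_eq:
  assumes "b \<in> carrier_vec s"
  shows "colim_scale M c (colim_class b) = colim_class (c \<cdot>\<^sub>v b)"
  unfolding colim_scale_def
proof (rule the_equality)
  obtain u where "carrier_vec s \<subseteq> (supported r s u :: 'k vec set)" using ex_supported_carrier by blast
  then have u: "b \<in> supported r s u" using assms by auto
  show "\<exists>u a. (u, a) \<in> colim_class b \<and> colim_class (c \<cdot>\<^sub>v b) = to_colim M u (pscale M c a)"
    using u to_colim_eq[OF supported_smult[OF u]]
    by (intro exI[of _ u] exI[of _ "\<psi> u b"]) (simp add: colim_class_def scale)
next
  fix Z assume "\<exists>u a. (u, a) \<in> colim_class b \<and> Z = to_colim M u (pscale M c a)"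
  then show "Z = colim_class (c \<cdot>\<^sub>v b)"
    using to_colim_eq[OF supported_smult] by (auto simp: colim_class_def scale[symmetric])
qed

lemma colim_vec_eq:
  assumes b: "b \<in> carrier_vec s" and m: "\<And>i. i < s \<Longrightarrow> m i = \<psi> (r i) (unit_vec s i)"
  shows "colim_vec M r m b = colim_class b"
proof -
  \<comment> \<open>Generalised to arbitrary lists for the induction; distinctness ensures that each
    coordinate is added only once.\<close>
  have "foldr (\<lambda>i. colim_add M (colim_scale M (b $ i) (to_colim M (r i) (m i)))) xs (colim_zero M) =
      colim_class (vec s (\<lambda>i. if i \<in> set xs then b $ i else 0))" (is "?fold xs = colim_class (?b xs)")
    if "distinct xs" "set xs \<subseteq> {..<s}" for xs
    using that
  proof (induction xs)
    case Nil
    have "?b [] = 0\<^sub>v s" by auto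
    then show ?case by (simp add: colim_zero_eq)
  next
    case (Cons i xs)
    have "unit_vec s i \<in> supported r s (r i)" by (auto simp: supported_def unit_vec_def)
    then have "to_colim M (r i) (m i) = colim_class (unit_vec s i)"
      using m Cons.prems to_colim_eq by simp
    then have "?fold (i # xs) = colim_class (b $ i \<cdot>\<^sub>v unit_vec s i + ?b xs)"
      using Cons by (simp add: colim_scale_eq colim_add_eq)
    also have "b $ i \<cdot>\<^sub>v unit_vec s i + ?b xs = ?b (i # xs)"
      using Cons.prems by (intro eq_vecI) auto
    finally show ?case .
  qed
  from this[of "[0..<s]"] have "colim_vec M r m b = colim_class (vec s (\<lambda>i. if i < s then b $ i else 0))"
    using b by (simp add: colim_vec_def lessThan_atLeast0)
  also have "vec s (\<lambda>i. if i < s then b $ i else 0) = b" using b by auto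
  finally show ?thesis .
qed

lemma colim_span_eq:
  assumes B: "B \<in> carrier_mat s l" and V: "colim_subspace M V"
    and span: "colim_span M {colim_class (col B j) | j. j < l} = V"
  shows "V = colim_class ` colspace B"
proof
  let ?S = "{colim_class (col B j) | j. j < l}"
  have "?S \<subseteq> colim_class ` colspace B"
  proof
    fix X assume "X \<in> ?S"
    then obtain j where j: "j < l" "X = colim_class (col B j)" by auto
    have "col B j = B *\<^sub>v unit_vec l j" using B j by (metis mult_mat_unit_vec)
    then show "X \<in> colim_class ` colspace B" using B j colspaceI by (metis imageI unit_vec_carrier)
  qed
  moreover have "colim_subspace M (colim_class ` colspace B)"
    unfolding colim_subspace_def
  proof (intro conjI ballI allI)
    have car: "x \<in> carrier_vec l \<Longrightarrow> B *\<^sub>v x \<in> carrier_vec s" for x using B by auto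
    show "colim_class ` colspace B \<subseteq> colim M"
      using B car by (auto simp: colspace_def intro!: colim_class_in_colim)
    have "B *\<^sub>v 0\<^sub>v l = 0\<^sub>v s" using B by auto
    then show "colim_zero M \<in> colim_class ` colspace B"
      using B unfolding colspace_def colim_zero_eq by (metis (mono_tags, lifting) carrier_matD(2)
        image_eqI mem_Collect_eq zero_carrier_vec)
    fix X assume "X \<in> colim_class ` colspace B"
    then obtain x where x: "x \<in> carrier_vec l" "X = colim_class (B *\<^sub>v x)"
      using B by (auto simp: colspace_def)
    show "colim_scale M c X \<in> colim_class ` colspace B" for c
    proof -
      have "colim_scale M c X = colim_class (B *\<^sub>v (c \<cdot>\<^sub>v x))"
        using x car B by (simp add: colim_scale_eq mult_mat_vec)
      then show ?thesis using x colspaceI[OF B] by (metis imageI smult_carrier_vec)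
    qed
    fix Y assume "Y \<in> colim_class ` colspace B"
    then obtain y where y: "y \<in> carrier_vec l" "Y = colim_class (B *\<^sub>v y)"
      using B by (auto simp: colspace_def)
    have "colim_add M X Y = colim_class (B *\<^sub>v (x + y))"
      using x y car B by (simp add: colim_add_eq mult_add_distrib_mat_vec[OF B])
    then show "colim_add M X Y \<in> colim_class ` colspace B"
      using x y colspaceI[OF B] by (metis imageI add_carrier_vec)
  qed
  ultimately show "V \<subseteq> colim_class ` colspace B"
    unfolding span[symmetric] colim_span_def by (rule hull_minimal)
  show "colim_class ` colspace B \<subseteq> V"
  proof -
    have cols: "colim_class (col B j) \<in> V" if "j < l" for j
      using that hull_subset[of ?S "colim_subspace M"] span unfolding colim_span_def by blast
    have "colim_class (B *\<^sub>v x) \<in> V" if x: "x \<in> carrier_vec l" for x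
    proof -
      \<comment> \<open>Closure of \<open>V\<close> is known only for binary sums and scalings, so
        the combination is built up one column at a time.\<close>
      let ?x = "\<lambda>n. vec l (\<lambda>j. if j < n then x $ j else 0)"
      have "n \<le> l \<Longrightarrow> colim_class (B *\<^sub>v ?x n) \<in> V" for n
      proof (induction n)
        case 0
        have "B *\<^sub>v ?x 0 = 0\<^sub>v s" using B by (intro eq_vecI) (auto simp: scalar_prod_def)
        then show ?case using V by (simp add: colim_subspace_def colim_zero_eq)
      next
        case (Suc n)
        have "?x (Suc n) = ?x n + x $ n \<cdot>\<^sub>v unit_vec l n"
          using Suc.prems by (intro eq_vecI) (auto simp: less_Suc_eq)
        then have "B *\<^sub>v ?x (Suc n) = B *\<^sub>v ?x n + x $ n \<cdot>\<^sub>v col B n"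
          using Suc.prems B mult_mat_unit_vec[OF B, of n]
          by (simp add: mult_add_distrib_mat_vec[OF B] mult_mat_vec[OF B])
        moreover have "B *\<^sub>v ?x n \<in> carrier_vec s" "col B n \<in> carrier_vec s" using B by auto
        ultimately have "colim_class (B *\<^sub>v ?x (Suc n)) =
            colim_add M (colim_class (B *\<^sub>v ?x n)) (colim_scale M (x $ n) (colim_class (col B n)))"
          by (simp add: colim_scale_eq colim_add_eq)
        then show ?case using Suc cols[of n] V unfolding colim_subspace_def by auto
      qed
      moreover have "?x l = x" using x by auto
      ultimately show ?thesis by (metis order_refl)
    qed
    then show ?thesis using B by (auto simp: colspace_def)
  qed
qed

section \<open>The submodule [V]_M in coordinates\<close>

text \<open>Since \<open>colim_class\<close> is injective, membership in the subspace of the colimit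
  can be tested on the coordinate vector.\<close>

lemma pspace_bracket:
  assumes "W \<subseteq> carrier_vec s"
  shows "pspace (bracket M (colim_class ` W)) z = \<psi> z ` (supported r s z \<inter> W)"
proof -
  have "to_colim M z (\<psi> z b) \<in> colim_class ` W \<longleftrightarrow> b \<in> W" if "b \<in> supported r s z" for b
    using that assms colim_class_inj supported_carrier to_colim_eq by blast
  then have "{a \<in> \<psi> z ` supported r s z. to_colim M z a \<in> colim_class ` W} =
      \<psi> z ` (supported r s z \<inter> W)" by blast
  then show ?thesis by (simp add: bracket_def pspace_eq)
qed

lemma persistence_module_bracket:
  assumes B: "B \<in> carrier_mat s l"
  shows "persistence_module (bracket M (colim_class ` colspace B))" (is "persistence_module ?N")
proof -
  interpret vector_space "pscale M" using module by (simp add: persistence_module_def)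
  have "colspace B \<subseteq> carrier_vec s" using B by (auto simp: colspace_def)
  note space = pspace_bracket[OF this]
  have N: "pscale ?N = pscale M" "pmap ?N = pmap M" "pspace ?N z \<subseteq> pspace M z" for z
    by (auto simp: bracket_def)
  have sub: "subspace (pspace ?N z)" for z
    unfolding subspace_def
  proof (intro conjI ballI allI)
    have "0\<^sub>v s = B *\<^sub>v 0\<^sub>v l" using B by auto
    then have "0\<^sub>v s \<in> colspace B"
      using colspaceI[OF B] by (metis zero_carrier_vec)
    then have "0\<^sub>v s \<in> supported r s z \<inter> colspace B"
      using supported_zero by blast
    then show "0 \<in> pspace ?N z" unfolding space zero[of z, symmetric] by blast
    fix a assume "a \<in> pspace ?N z"
    then obtain x where x: "x \<in> carrier_vec l" "B *\<^sub>v x \<in> supported r s z" "a = \<psi> z (B *\<^sub>v x)"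
      unfolding space using colspaceE[OF B] by blast
    show "pscale M c a \<in> pspace ?N z" for c
    proof -
      have "pscale M c a = \<psi> z (B *\<^sub>v (c \<cdot>\<^sub>v x))" "B *\<^sub>v (c \<cdot>\<^sub>v x) \<in> supported r s z"
        using x supported_smult[OF x(2), of c] by (auto simp: mult_mat_vec[OF B] scale)
      then show ?thesis using x colspaceI[OF B, of "c \<cdot>\<^sub>v x"] unfolding space by auto
    qed
    fix a' assume "a' \<in> pspace ?N z"
    then obtain y where y: "y \<in> carrier_vec l" "B *\<^sub>v y \<in> supported r s z" "a' = \<psi> z (B *\<^sub>v y)"
      unfolding space using colspaceE[OF B] by blast
    have "a + a' = \<psi> z (B *\<^sub>v (x + y))" "B *\<^sub>v (x + y) \<in> supported r s z"
      using x y supported_add[OF x(2) y(2)] by (auto simp: mult_add_distrib_mat_vec[OF B] add)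
    then show "a + a' \<in> pspace ?N z" using x y colspaceI[OF B, of "x + y"] unfolding space by auto
  qed
  have "\<exists>S. finite S \<and> span S = pspace ?N z" for z
  proof -
    obtain S where S: "finite S" "span S = pspace M z"
      using module unfolding persistence_module_def by metis
    \<comment> \<open>A maximal independent subset spans the subspace, and a finite spanning set of
      the whole component bounds its size.\<close>
    obtain T where T: "T \<subseteq> pspace ?N z" "independent T" "pspace ?N z \<subseteq> span T"
      using maximal_independent_subset by blast
    have "T \<subseteq> span S" using T(1) N(3) S(2) by blast
    then have "finite T" using independent_span_bound[OF S(1) T(2)] by blast
    moreover have "span T = pspace ?N z" using T sub span_minimal by blast
    ultimately show ?thesis by blast
  qed
  moreover have "linear_between (pscale M) (pspace ?N z) (pscale M) (pspace ?N w) (pmap M z w)"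
    if "z \<le> w" for z w
  proof -
    have "linear_between (pscale M) (pspace M z) (pscale M) (pspace M w) (pmap M z w)"
      using module that unfolding persistence_module_def by blast
    moreover have "pmap M z w a \<in> pspace ?N w" if "a \<in> pspace ?N z" for a
    proof -
      obtain b where b: "b \<in> supported r s z" "b \<in> colspace B" "a = \<psi> z b"
        using \<open>a \<in> pspace ?N z\<close> unfolding space by blast
      then have "pmap M z w a = \<psi> w b" using \<open>z \<le> w\<close> by (simp add: map)
      then show ?thesis
        using b supported_mono[OF b(1) \<open>z \<le> w\<close>] unfolding space by blast
    qed
    ultimately show ?thesis using N(3) unfolding linear_between_def by blast
  qed
  ultimately show ?thesis
    using module sub N(3)[THEN subsetD] unfolding persistence_module_def N(1,2) by simp
qed

end

section \<open>From bases to coordinates and back\<close>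

lemma is_basis_coordinates:
  fixes M :: "('k::field, 'v::ab_group_add) pmod"
  assumes "is_basis M {..<s} r m"
  obtains \<psi> where "coordinates M s r \<psi>" "\<And>i. i < s \<Longrightarrow> m i = \<psi> (r i) (unit_vec s i)"
proof -
  let ?D = "direct_sum {..<s} (\<lambda>i. free_on (r i)) :: ('k, nat \<Rightarrow> 'k) pmod"
  obtain f where f: "pmod_iso ?D M f"
    and m: "\<forall>i<s. f (r i) (\<lambda>i'. if i' = i then 1 else 0) = m i"
    using assms unfolding is_basis_def by auto
  \<comment> \<open>Padding by zeros identifies vectors with elements of the direct sum, which must
    vanish outside the index set.\<close>
  define F :: "'k vec \<Rightarrow> nat \<Rightarrow> 'k" where "F b = (\<lambda>i. if i < s then b $ i else 0)" for b
  define \<psi> where "\<psi> z b = f z (F b)" for z b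
  note space = pspace_direct_sum_free[OF finite_lessThan, of s r]
  have F: "F b \<in> pspace ?D z" if "b \<in> supported r s z" for b z
    using that by (auto simp: space F_def supported_def)
  have F_bij: "bij_betw F (supported r s z) (pspace ?D z)" for z
  proof (rule bij_betw_byWitness[where f' = "\<lambda>h. vec s h"])
    show "\<forall>b\<in>supported r s z. vec s (F b) = b" by (auto simp: F_def supported_def)
    show "\<forall>h\<in>pspace ?D z. F (vec s h) = h"
    proof (intro ballI ext)
      show "F (vec s h) i = h i" if "h \<in> pspace ?D z" for h i
        using that by (cases "h i = 0") (auto simp: F_def space)
    qed
    show "F ` supported r s z \<subseteq> pspace ?D z" using F by blast
    show "vec s ` pspace ?D z \<subseteq> supported r s z" by (auto simp: space supported_def)
  qed
  have lin: "\<forall>x\<in>pspace ?D z. \<forall>y\<in>pspace ?D z. f z (x + y) = f z x + f z y"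
    "\<forall>c. \<forall>x\<in>pspace ?D z. f z (\<lambda>i. c * x i) = pscale M c (f z x)" for z
    using f unfolding pmod_iso_def linear_between_def pscale_direct_sum_free by blast+
  have "coordinates M s r \<psi>"
  proof
    show "persistence_module M" using f by (simp add: pmod_iso_def)
    show "bij_betw (\<psi> z) (supported r s z) (pspace M z)" for z
      using bij_betw_trans[OF F_bij, of "f z" z "pspace M z"] f
      unfolding pmod_iso_def \<psi>_def comp_def by blast
  next
    fix b b' :: "'k vec" and z assume b: "b \<in> supported r s z" "b' \<in> supported r s z"
    have "F (b + b') = F b + F b'" using b by (auto simp: F_def supported_def)
    then show "\<psi> z (b + b') = \<psi> z b + \<psi> z b'" using lin F b by (simp add: \<psi>_def)
  next
    fix b :: "'k vec" and z c assume b: "b \<in> supported r s z"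
    have "F (c \<cdot>\<^sub>v b) = (\<lambda>i. c * F b i)" using b by (auto simp: F_def supported_def)
    then show "\<psi> z (c \<cdot>\<^sub>v b) = pscale M c (\<psi> z b)" using lin F b by (simp add: \<psi>_def)
  next
    fix z w and b :: "'k vec" assume "z \<le> w" and b: "b \<in> supported r s z"
    then have "pmap M z w (f z (F b)) = f w (pmap ?D z w (F b))"
      using f F[OF b] unfolding pmod_iso_def by metis
    then show "pmap M z w (\<psi> z b) = \<psi> w b"
      by (simp add: \<psi>_def pmap_direct_sum_free[OF finite_lessThan F[OF b]])
  qed
  moreover have "m i = \<psi> (r i) (unit_vec s i)" if "i < s" for i
  proof -
    have "F (unit_vec s i) = (\<lambda>i'. if i' = i then 1 else 0)" using that by (auto simp: F_def)
    then show ?thesis using m that by (simp add: \<psi>_def)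
  qed
  ultimately show thesis using that by blast
qed

text \<open>The lex pivot of a column attains the largest first coordinate of its row grades and the colex pivot
  the largest second coordinate, so together they control the column grade.\<close>

lemma col_grade_le:
  fixes B :: "'k::field mat"
  assumes B: "B \<in> carrier_mat s l" and "lex.distinct_pivots r B" "colex.distinct_pivots r B"
    and x: "x \<in> carrier_vec l" "B *\<^sub>v x \<in> supported r s z"
    and j: "j < l" "x $ j \<noteq> 0" "vsupp (col B j) \<noteq> {}"
  shows "Sup_fin (r ` vsupp (col B j)) \<le> z"
proof -
  obtain i i' where i: "l_piv r (col B j) = Some i" "c_piv r (col B j) = Some i'"
    using j(3) by (metis lex.graded_pivot_eq_None_iff colex.graded_pivot_eq_None_iff not_Some_eq)
  have grade: "r k \<le> z" if "k \<in> vsupp (B *\<^sub>v x)" for k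
    using that x(2) B by (auto simp: in_vsupp_iff supported_def)
  obtain k where k: "lex_le (r i) (r k)" "r k \<le> z"
    using lex.distinct_pivots_dominate[OF B assms(2) x(1) j(1,2) i(1)] grade by blast
  obtain k' where k': "colex_le (r i') (r k')" "r k' \<le> z"
    using colex.distinct_pivots_dominate[OF B assms(3) x(1) j(1,2) i(2)] grade by blast
  have "r n \<le> z" if "n \<in> vsupp (col B j)" for n
  proof -
    have "n = i \<or> lex.below r n i" "n = i' \<or> colex.below r n i'"
      using that i unfolding lex.graded_pivot_eq_Some_iff colex.graded_pivot_eq_Some_iff by auto
    then have "lex_le (r n) (r i)" "colex_le (r n) (r i')"
      using lex.below_imp_R colex.below_imp_R by blast+
    then show ?thesis using k k' unfolding lex_le_def colex_le_def less_eq_prod_def by linarith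
  qed
  then show ?thesis using j(3) by (intro Sup_fin.boundedI) auto
qed

text \<open>The isomorphism sends a coefficient function \<open>h\<close> to the combination
  \<open>B *\<^sub>v vec l h\<close>. Independence of the nonzero columns gives injectivity, and
  \<open>col_grade_le\<close> gives surjectivity: a combination existing at \<open>z\<close> uses
  only columns whose grade is below \<open>z\<close>.\<close>

lemma (in coordinates) is_basis_bracket:
  assumes B: "B \<in> carrier_mat s l" and "lex.distinct_pivots r B" "colex.distinct_pivots r B"
    and m: "\<And>i. i < s \<Longrightarrow> m i = \<psi> (r i) (unit_vec s i)"
  shows "is_basis (bracket M (colim_class ` colspace B)) (nonzero_cols (graded r B))
           (col_grade (graded r B)) (represented M m (graded r B))"
proof -
  let ?N = "bracket M (colim_class ` colspace B)"
  define J where "J = nonzero_cols (graded r B)"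
  define c where "c = col_grade (graded r B)"
  let ?D = "direct_sum J (\<lambda>j. free_on (c j)) :: ('k, nat \<Rightarrow> 'k) pmod"
  have J: "j \<in> J \<longleftrightarrow> j < l \<and> vsupp (col B j) \<noteq> {}" for j
    using B by (auto simp: J_def nonzero_cols_def graded_def)
  then have J_subset: "J \<subseteq> {..<l}" by auto
  then have fin: "finite J" using finite_subset by blast
  note D = pspace_direct_sum_free[OF fin, of c]
  have "colspace B \<subseteq> carrier_vec s" using B by (auto simp: colspace_def)
  note N = pspace_bracket[OF this]
  have B_nth: "(B *\<^sub>v x) $ i = (\<Sum>j<l. B $$ (i, j) * x $ j)" if "x \<in> carrier_vec l" "i < s" for x i
    using B that by (auto simp: scalar_prod_def atLeast0LessThan intro!: sum.cong)
  have nonzero: "j \<in> J \<and> r i \<le> c j" if "i < s" "j < l" "B $$ (i, j) \<noteq> 0" for i j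
  proof -
    have i: "i \<in> vsupp (col B j)" using that B by (auto simp: in_vsupp_iff)
    then have "r i \<le> c j" by (auto simp: c_def graded_def intro!: Sup_fin.coboundedI)
    then show ?thesis using i that J by auto
  qed
  let ?f = "\<lambda>z h. \<psi> z (B *\<^sub>v vec l h)"
  \<comment> \<open>A nonzero row of the combination meets some column in use, so its grade is at
    most that column's grade, which is at most \<open>z\<close>.\<close>
  have mem: "B *\<^sub>v vec l h \<in> supported r s z \<inter> colspace B" if h: "h \<in> pspace ?D z" for h z
  proof
    have "r i \<le> z" if i: "i < s" "(B *\<^sub>v vec l h) $ i \<noteq> 0" for i
    proof -
      have "(\<Sum>j<l. B $$ (i, j) * h j) \<noteq> 0" using i by (simp add: B_nth)
      then obtain j where "j < l" "B $$ (i, j) \<noteq> 0" "h j \<noteq> 0"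
        by (metis (no_types, lifting) lessThan_iff mult_zero_left mult_zero_right sum.neutral)
      then show ?thesis using nonzero[of i j] h i order_trans unfolding D by blast
    qed
    then show "B *\<^sub>v vec l h \<in> supported r s z" using B by (auto simp: supported_def)
    show "B *\<^sub>v vec l h \<in> colspace B" using B by (auto simp: colspace_def)
  qed
  have lin: "linear_between (pscale ?D) (pspace ?D z) (pscale ?N) (pspace ?N z) (?f z)" for z
    unfolding linear_between_def
  proof (intro conjI ballI allI)
    fix h assume h: "h \<in> pspace ?D z"
    show "?f z h \<in> pspace ?N z" using mem[OF h] unfolding N by blast
    show "?f z (pscale ?D a h) = pscale ?N a (?f z h)" for a
    proof -
      have "vec l (\<lambda>j. a * h j) = a \<cdot>\<^sub>v vec l h" by auto
      then have "B *\<^sub>v vec l (\<lambda>j. a * h j) = a \<cdot>\<^sub>v (B *\<^sub>v vec l h)" by (simp add: mult_mat_vec[OF B])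
      then show ?thesis using mem[OF h] by (simp add: pscale_direct_sum_free scale bracket_def)
    qed
    fix h' assume h': "h' \<in> pspace ?D z"
    have "vec l (h + h') = vec l h + vec l h'" by auto
    then have "B *\<^sub>v vec l (h + h') = B *\<^sub>v vec l h + B *\<^sub>v vec l h'"
      by (simp add: mult_add_distrib_mat_vec[OF B])
    then show "?f z (h + h') = ?f z h + ?f z h'" using mem[OF h] mem[OF h'] by (simp add: add)
  qed
  have "bij_betw (?f z) (pspace ?D z) (pspace ?N z)" for z
    unfolding bij_betw_def
  proof
    show "inj_on (?f z) (pspace ?D z)"
    proof (rule inj_onI)
      fix h h' assume h: "h \<in> pspace ?D z" "h' \<in> pspace ?D z" and "?f z h = ?f z h'"
      then have eq: "B *\<^sub>v vec l h = B *\<^sub>v vec l h'" using mem[OF h(1)] mem[OF h(2)] inj by blast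
      define y where "y = vec l (\<lambda>j. h j - h' j)"
      have y: "y \<in> carrier_vec l" by (simp add: y_def)
      have zero: "vsupp (B *\<^sub>v y) = {}"
      proof -
        have "(B *\<^sub>v y) $ i = (B *\<^sub>v vec l h) $ i - (B *\<^sub>v vec l h') $ i" if "i < s" for i
          using that y by (simp add: B_nth y_def sum_subtractf right_diff_distrib)
        then show ?thesis using eq B by (auto simp: in_vsupp_iff)
      qed
      show "h = h'"
      proof
        fix j
        show "h j = h' j"
        proof (cases "j \<in> J")
          case True
          then obtain i where "l_piv r (col B j) = Some i" "j < l"
            using J by (metis lex.graded_pivot_eq_None_iff not_Some_eq)
          \<comment> \<open>Otherwise the pivot of column \<open>j\<close> would be dominated by a
            row in the support of \<open>B *\<^sub>v y\<close>, which is empty.\<close>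
          then have "y $ j = 0"
            using lex.distinct_pivots_dominate[OF B assms(2) y, of j i] zero by blast
          then show ?thesis using \<open>j < l\<close> by (simp add: y_def)
        next
          case False
          then have "h j = 0" "h' j = 0" using h unfolding D by blast+
          then show ?thesis by simp
        qed
      qed
    qed
    show "?f z ` pspace ?D z = pspace ?N z"
    proof
      show "?f z ` pspace ?D z \<subseteq> pspace ?N z" using mem unfolding N by blast
      show "pspace ?N z \<subseteq> ?f z ` pspace ?D z"
      proof
        fix a assume "a \<in> pspace ?N z"
        then obtain x where x: "x \<in> carrier_vec l" "B *\<^sub>v x \<in> supported r s z" "a = \<psi> z (B *\<^sub>v x)"
          unfolding N using colspaceE[OF B] by blast
        \<comment> \<open>Coefficients at zero columns are arbitrary in \<open>x\<close>, but have
          no place in the direct sum; dropping them does not change the product.\<close>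
        define h where "h j = (if j \<in> J then x $ j else 0)" for j
        have "B *\<^sub>v vec l h = B *\<^sub>v x"
        proof (rule eq_vecI)
          fix i assume "i < dim_vec (B *\<^sub>v x)"
          then have i: "i < s" using B by simp
          show "(B *\<^sub>v vec l h) $ i = (B *\<^sub>v x) $ i"
            using i x(1) nonzero[OF i] by (fastforce simp: B_nth h_def intro!: sum.cong)
        qed simp
        moreover have "h \<in> pspace ?D z"
          using col_grade_le[OF assms(1-3) x(1,2)] J
          unfolding D by (auto simp: h_def c_def graded_def)
        ultimately show "a \<in> ?f z ` pspace ?D z" using x(3) by (metis image_eqI)
      qed
    qed
  qed
  moreover have "\<forall>a\<in>pspace ?D z. ?f w (pmap ?D z w a) = pmap ?N z w (?f z a)" if "z \<le> w" for z w
  proof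
    fix h assume h: "h \<in> pspace ?D z"
    show "?f w (pmap ?D z w h) = pmap ?N z w (?f z h)"
      using mem[OF h] map[OF that, of "B *\<^sub>v vec l h"]
      by (simp add: pmap_direct_sum_free[OF fin h] bracket_def)
  qed
  ultimately have iso: "pmod_iso ?D ?N ?f"
    unfolding pmod_iso_def
    using persistence_module_direct_sum_free[OF fin] persistence_module_bracket[OF B] lin by blast
  have "?f (c j) (\<lambda>i. if i = j then 1 else 0) = represented M m (graded r B) j" if "j \<in> J" for j
  proof -
    interpret vector_space "pscale M" using module by (simp add: persistence_module_def)
    have j: "j < l" using that J by simp
    have "vec l (\<lambda>i. if i = j then 1 else 0) = unit_vec l j" by (auto simp: unit_vec_def)
    then have eq: "B *\<^sub>v vec l (\<lambda>i. if i = j then 1 else 0) = col B j"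
      using mult_mat_unit_vec[OF B j] by metis
    \<comment> \<open>The join of its row grades is a grade at which the column exists, so its
      expansion in the basis of \<open>M\<close> is the represented element.\<close>
    have "col B j \<in> supported r s (c j)" using nonzero[OF _ j] B j by (auto simp: supported_def)
    then have "\<psi> (c j) (col B j) =
        (\<Sum>i<s. pscale M (col B j $ i) (pmap M (r i) (c j) (\<psi> (r i) (unit_vec s i))))"
      by (rule basis_expansion)
    also have "\<dots> = represented M m (graded r B) j"
      using B j m by (auto simp: represented_def graded_def c_def intro!: sum.cong)
    finally show ?thesis unfolding eq .
  qed
  with iso show ?thesis unfolding is_basis_def J_def c_def by blast
qed

theorem theorem19:
  fixes M :: "('k::field, 'v::ab_group_add) pmod"
    and V :: "(grade \<times> 'v) set set"
    and s l :: nat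
    and r :: "nat \<Rightarrow> grade"
    and m :: "nat \<Rightarrow> 'v"
    and B :: "'k mat"
  assumes "persistence_module M"
    and "is_basis M {..<s} r m"
    and "colim_subspace M V"
    and "B \<in> carrier_mat s l"
    and "colim_span M {colim_vec M r m (col B j) | j. j < l} = V"
  shows "is_free (bracket M V) \<and>
    (\<exists>G. bireduce r B = Some G \<and>
         is_basis (bracket M V) (nonzero_cols G) (col_grade G) (represented M m G))"
proof -
  obtain \<psi> where "coordinates M s r \<psi>" and m: "\<And>i. i < s \<Longrightarrow> m i = \<psi> (r i) (unit_vec s i)"
    using is_basis_coordinates[OF assms(2)] by blast
  then interpret coordinates M s r \<psi> by simp
  have "colim_vec M r m (col B j) = colim_class (col B j)" for j
    using assms(4) m by (intro colim_vec_eq) auto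
  \<comment> \<open>\<open>V\<close> now depends on the matrix only through its column space, which
    the algorithm preserves.\<close>
  then have V: "V = colim_class ` colspace B"
    using colim_span_eq[OF assms(4,3)] assms(5) by simp
  obtain B' where B': "bireduce r B = Some (graded r B')" "B' \<in> carrier_mat s l"
    "colspace B' = colspace B" "lex.distinct_pivots r B'" "colex.distinct_pivots r B'"
    using bireduce_terminates[OF assms(4)] by blast
  have basis: "is_basis (bracket M V) (nonzero_cols (graded r B')) (col_grade (graded r B'))
      (represented M m (graded r B'))"
    using is_basis_bracket[OF B'(2,4,5) m] B'(3) V by simp
  then have "is_free (bracket M V)" unfolding is_basis_def is_free_def by blast
  with basis B'(1) show ?thesis by blast
qed

end
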